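(* Let $\varrho\in\mathcal{R}_p(1)$ and let $v,d\ge 0$. Then the map $f_\varrho:\mathbf{E}\langle v,d\rangle\to\mathbf{E}\langle v,d\rangle$, $f_\varrho(\xi)=\xi*\varrho$ (taken as the element of $\mathbf{E}[v,d]$ containing $\xi*\varrho$), is well defined (sends characteristic minmatrices to characteristic minmatrices) and is a lattice automorphism of $\mathbf{E}\langle v,d\rangle$.
   Context: Language: propositional variables $p_1,p_2,\dots$, constants $0,1$, connectives $\neg,\vee$ (others as abbreviations), modal operator $\lozenge$, $\square\varphi:=\neg\lozenge\neg\varphi$. $\mathbf{E}$ is the smallest set of formulas containing all propositional tautologies and closed under modus ponens, uniform substitution and the rule RE: from $\varphi\leftrightarrow\psi$ infer $\lozenge\varphi\leftrightarrow\lozenge\psi$. A classical modal logic is a set of formulas containing $\mathbf{E}$ closed under these three rules. $\varphi\approx\psi$ means $\vdash_{\mathbf{E}}\varphi\leftrightarrow\psi$. The modal degree of a formula is the maximal nesting depth of $\lozenge$; $\mathcal{F}(v,d)$ is the set of formulas in variables among $p_1,\dots,p_v$ of modal degree $\le d$, and $\mathbf{E}[v,d]=\mathcal{F}(v,d)/\approx$, a finite Boolean algebra ordered by $\mathbf{E}$-provable implication. Characteristic minmatrices: for a classical modal logic $\mathbf{S}$, its characteristic minmatrix $\langle\mathbf{S}\rangle_{v,d}\in\mathbf{E}[v,d]$ is the class of the conjunction of all $\mathbf{S}$-theorems in $\mathcal{F}(v,d)$ (finitely many up to $\approx$). $\mathbf{E}\langle v,d\rangle$ is the set of all such $\langle\mathbf{S}\rangle_{v,d}$,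 ordered by $\mathbf{E}$-provable implication (equivalently inclusion of sets of canonical minterms); it is regarded as a lattice under this order. Uniform replacements: a UR is a formula $\rho(e)$ of modal degree $\le1$ in one variable $e$. $\varphi*\rho$ is defined recursively: $0*\rho=0$, $1*\rho=1$, $p_i*\rho=p_i$, $(\psi\vee\theta)*\rho=(\psi*\rho)\vee(\theta*\rho)$, $(\neg\psi)*\rho=\neg(\psi*\rho)$, $(\lozenge\psi)*\rho=\rho(\psi*\rho)$ (substitute $\psi*\rho$ for $e$ in $\rho$). $\mathcal{R}_p(1)$ is the set of 24 URs: $\lambda\leftrightarrow\tau$ with $\lambda\in\{\lozenge e,\neg\lozenge e\}$, $\tau\in\{1,e,e\vee\lozenge\neg e,e\vee\neg\lozenge\neg e,\neg e\vee\lozenge\neg e,\neg e\vee\neg\lozenge\neg e\}$, and $\lambda\leftrightarrow\tau$ with $\lambda\in\{\lozenge\neg e,\neg\lozenge\neg e\}$, $\tau\in\{1,e,e\vee\lozenge e,e\vee\neg\lozenge e,\neg e\vee\lozenge e,\neg e\vee\neg\lozenge e\}$. *)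

theory Defs
  imports "HOL-Algebra.Lattice"
begin

text \<open>\<open>Var i\<close> is the propositional variable \<open>p\<^bsub>i+1\<^esub>\<close>, so the variables
  \<open>p\<^sub>1, \<dots>, p\<^sub>v\<close> are those with index \<open>< v\<close>.\<close>

datatype fm = Fls | Tru | Var nat | Neg fm | Or fm fm | Dia fm

abbreviation And :: "fm \<Rightarrow> fm \<Rightarrow> fm" where
  "And \<phi> \<psi> \<equiv> Neg (Or (Neg \<phi>) (Neg \<psi>))"

abbreviation Imp :: "fm \<Rightarrow> fm \<Rightarrow> fm" where
  "Imp \<phi> \<psi> \<equiv> Or (Neg \<phi>) \<psi>"

abbreviation Iff :: "fm \<Rightarrow> fm \<Rightarrow> fm" where
  "Iff \<phi> \<psi> \<equiv> And (Imp \<phi> \<psi>) (Imp \<psi> \<phi>)"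

primrec Conj :: "fm list \<Rightarrow> fm" where
  "Conj [] = Tru"
| "Conj (\<phi> # \<phi>s) = And \<phi> (Conj \<phi>s)"

primrec vars :: "fm \<Rightarrow> nat set" where
  "vars Fls = {}"
| "vars Tru = {}"
| "vars (Var i) = {i}"
| "vars (Neg \<phi>) = vars \<phi>"
| "vars (Or \<phi> \<psi>) = vars \<phi> \<union> vars \<psi>"
| "vars (Dia \<phi>) = vars \<phi>"

primrec mdeg :: "fm \<Rightarrow> nat" where
  "mdeg Fls = 0"
| "mdeg Tru = 0"
| "mdeg (Var i) = 0"
| "mdeg (Neg \<phi>) = mdeg \<phi>"
| "mdeg (Or \<phi> \<psi>) = max (mdeg \<phi>) (mdeg \<psi>)"
| "mdeg (Dia \<phi>) = Suc (mdeg \<phi>)"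

primrec subst :: "(nat \<Rightarrow> fm) \<Rightarrow> fm \<Rightarrow> fm" where
  "subst \<sigma> Fls = Fls"
| "subst \<sigma> Tru = Tru"
| "subst \<sigma> (Var i) = \<sigma> i"
| "subst \<sigma> (Neg \<phi>) = Neg (subst \<sigma> \<phi>)"
| "subst \<sigma> (Or \<phi> \<psi>) = Or (subst \<sigma> \<phi>) (subst \<sigma> \<psi>)"
| "subst \<sigma> (Dia \<phi>) = Dia (subst \<sigma> \<phi>)"

text \<open>Boolean evaluation: \<open>V\<close> assigns truth values to the variables, and \<open>M\<close> to the
  formulas \<open>\<diamond>\<phi>\<close>, which count as atoms. The tautologies are thus the classical
  propositional ones together with their modal substitution instances.\<close>

primrec bval :: "(nat \<Rightarrow> bool) \<Rightarrow> (fm \<Rightarrow> bool) \<Rightarrow> fm \<Rightarrow> bool" where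
  "bval V M Fls = False"
| "bval V M Tru = True"
| "bval V M (Var i) = V i"
| "bval V M (Neg \<phi>) = (\<not> bval V M \<phi>)"
| "bval V M (Or \<phi> \<psi>) = (bval V M \<phi> \<or> bval V M \<psi>)"
| "bval V M (Dia \<phi>) = M \<phi>"

definition tautology :: "fm \<Rightarrow> bool" where
  "tautology \<phi> \<longleftrightarrow> (\<forall>V M. bval V M \<phi>)"

inductive_set logic_E :: "fm set" where
  taut: "tautology \<phi> \<Longrightarrow> \<phi> \<in> logic_E"
| MP: "\<lbrakk>\<phi> \<in> logic_E; Imp \<phi> \<psi> \<in> logic_E\<rbrakk> \<Longrightarrow> \<psi> \<in> logic_E"
| US: "\<phi> \<in> logic_E \<Longrightarrow> subst \<sigma> \<phi> \<in> logic_E"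
| RE: "Iff \<phi> \<psi> \<in> logic_E \<Longrightarrow> Iff (Dia \<phi>) (Dia \<psi>) \<in> logic_E"

definition classical_modal_logic :: "fm set \<Rightarrow> bool" where
  "classical_modal_logic S \<longleftrightarrow>
     logic_E \<subseteq> S \<and>
     (\<forall>\<phi> \<psi>. \<phi> \<in> S \<longrightarrow> Imp \<phi> \<psi> \<in> S \<longrightarrow> \<psi> \<in> S) \<and>
     (\<forall>\<phi> \<sigma>. \<phi> \<in> S \<longrightarrow> subst \<sigma> \<phi> \<in> S) \<and>
     (\<forall>\<phi> \<psi>. Iff \<phi> \<psi> \<in> S \<longrightarrow> Iff (Dia \<phi>) (Dia \<psi>) \<in> S)"

definition E_equiv :: "fm \<Rightarrow> fm \<Rightarrow> bool" (infix \<open>\<approx>\<^sub>E\<close> 50) where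
  "\<phi> \<approx>\<^sub>E \<psi> \<longleftrightarrow> Iff \<phi> \<psi> \<in> logic_E"

definition forms :: "nat \<Rightarrow> nat \<Rightarrow> fm set" where
  "forms v d = {\<phi>. vars \<phi> \<subseteq> {..<v} \<and> mdeg \<phi> \<le> d}"

definition E_rel :: "nat \<Rightarrow> nat \<Rightarrow> (fm \<times> fm) set" where
  "E_rel v d = {(\<phi>, \<psi>). \<phi> \<in> forms v d \<and> \<psi> \<in> forms v d \<and> \<phi> \<approx>\<^sub>E \<psi>}"

definition E_quot :: "nat \<Rightarrow> nat \<Rightarrow> fm set set" where
  "E_quot v d = forms v d // E_rel v d"

definition E_le :: "fm set \<Rightarrow> fm set \<Rightarrow> bool" where
  "E_le \<xi> \<eta> \<longleftrightarrow> (\<exists>\<phi>\<in>\<xi>. \<exists>\<psi>\<in>\<eta>. Imp \<phi> \<psi> \<in> logic_E)"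

text \<open>The conjunction of all theorems of \<open>S\<close> in \<open>forms v d\<close> is formed over a finite list of
  such theorems that meets every equivalence class of them. Such a list exists because
  \<open>E_quot v d\<close> is finite, and the class of the conjunction does not depend on its choice.\<close>

definition theorem_list :: "fm set \<Rightarrow> nat \<Rightarrow> nat \<Rightarrow> fm list" where
  "theorem_list S v d =
     (SOME \<phi>s. set \<phi>s \<subseteq> S \<inter> forms v d \<and> (\<forall>\<phi>\<in>S \<inter> forms v d. \<exists>\<psi>\<in>set \<phi>s. \<phi> \<approx>\<^sub>E \<psi>))"

definition char_minmatrix :: "fm set \<Rightarrow> nat \<Rightarrow> nat \<Rightarrow> fm set" where
  "char_minmatrix S v d = E_rel v d `` {Conj (theorem_list S v d)}"

definition char_minmatrices :: "nat \<Rightarrow> nat \<Rightarrow> fm set set" where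
  "char_minmatrices v d = {char_minmatrix S v d | S. classical_modal_logic S}"

definition minmatrix_order :: "nat \<Rightarrow> nat \<Rightarrow> fm set gorder" where
  "minmatrix_order v d = \<lparr>carrier = char_minmatrices v d, eq = (=), le = E_le\<rparr>"

text \<open>Both \<open>join_pres L L f\<close> and \<open>meet_pres L L f\<close> include that \<open>L\<close> is a lattice.\<close>

definition lattice_automorphism :: "('a, 'b) gorder_scheme \<Rightarrow> ('a \<Rightarrow> 'a) \<Rightarrow> bool" where
  "lattice_automorphism L f \<longleftrightarrow>
     bij_betw f (carrier L) (carrier L) \<and> join_pres L L f \<and> meet_pres L L f"

text \<open>In a uniform replacement, \<open>Var 0\<close> plays the role of the variable \<open>e\<close>.\<close>

abbreviation e_var :: fm where
  "e_var \<equiv> Var 0"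

definition uniform_replacements :: "fm set" where
  "uniform_replacements = {\<rho>. vars \<rho> \<subseteq> {0} \<and> mdeg \<rho> \<le> 1}"

primrec replace :: "fm \<Rightarrow> fm \<Rightarrow> fm" (infixl \<open>\<star>\<close> 75) where
  "Fls \<star> \<rho> = Fls"
| "Tru \<star> \<rho> = Tru"
| "Var i \<star> \<rho> = Var i"
| "Neg \<phi> \<star> \<rho> = Neg (\<phi> \<star> \<rho>)"
| "Or \<phi> \<psi> \<star> \<rho> = Or (\<phi> \<star> \<rho>) (\<psi> \<star> \<rho>)"
| "Dia \<phi> \<star> \<rho> = subst (Var(0 := \<phi> \<star> \<rho>)) \<rho>"

definition R_p1 :: "fm set" where
  "R_p1 =
     {Iff \<kappa> \<tau> | \<kappa> \<tau>.
        \<kappa> \<in> {Dia e_var, Neg (Dia e_var)} \<and>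
        \<tau> \<in> {Tru, e_var,
             Or e_var (Dia (Neg e_var)), Or e_var (Neg (Dia (Neg e_var))),
             Or (Neg e_var) (Dia (Neg e_var)), Or (Neg e_var) (Neg (Dia (Neg e_var)))}} \<union>
     {Iff \<kappa> \<tau> | \<kappa> \<tau>.
        \<kappa> \<in> {Dia (Neg e_var), Neg (Dia (Neg e_var))} \<and>
        \<tau> \<in> {Tru, e_var,
             Or e_var (Dia e_var), Or e_var (Neg (Dia e_var)),
             Or (Neg e_var) (Dia e_var), Or (Neg e_var) (Neg (Dia e_var))}}"

lemma R_p1_uniform_replacements: "R_p1 \<subseteq> uniform_replacements"
  by (auto simp: R_p1_def uniform_replacements_def)

definition replace_map :: "fm \<Rightarrow> nat \<Rightarrow> nat \<Rightarrow> fm set \<Rightarrow> fm set" where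
  "replace_map \<rho> v d \<xi> = (THE \<eta>. \<eta> \<in> E_quot v d \<and> (\<forall>\<phi>\<in>\<xi>. \<phi> \<star> \<rho> \<in> \<eta>))"

end

theory Submission
  imports Defs
begin

text \<open>At a fixed world, the value of a replacement in \<open>\<R>\<^sub>p(1)\<close> depends only on the truth
  values of \<open>e\<close>, \<open>\<diamond>e\<close> and \<open>\<diamond>\<not>e\<close>. For fixed \<open>e\<close> it induces a map on the pairs
  \<open>(\<diamond>e, \<diamond>\<not>e)\<close>, and the 24 replacements realise the 24 permutations of the four pairs. Hence
  each \<open>\<rho>\<close> has an inverse \<open>\<rho>'\<close> in \<open>\<R>\<^sub>p(1)\<close>, in the sense that \<open>\<phi> * \<rho> * \<rho>' \<approx> \<phi> \<approx> \<phi> * \<rho>' * \<rho>\<close>.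
  For a classical modal logic \<open>S\<close>, the set \<open>S' = {\<phi>. \<phi> * \<rho>' \<in> S}\<close> is again one, and
  \<open>\<langle>S\<rangle> * \<rho> = \<langle>S'\<rangle>\<close>. Since \<open>\<langle>S\<rangle> \<le> \<langle>T\<rangle>\<close> amounts to \<open>T \<inter> \<F>(v,d) \<subseteq> S \<inter> \<F>(v,d)\<close>, the order on
  minmatrices is dual to a closure system, hence a lattice, and \<open>\<rho>\<close> acts on it by an order
  isomorphism.\<close>

section \<open>Classical modal logics\<close>

lemma classical_modal_logic_E: "classical_modal_logic logic_E"
  unfolding classical_modal_logic_def
  by (auto intro: logic_E.US logic_E.RE elim: logic_E.MP)

lemma E_subset_logic: "classical_modal_logic S \<Longrightarrow> \<phi> \<in> logic_E \<Longrightarrow> \<phi> \<in> S"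
  unfolding classical_modal_logic_def by blast

lemma logic_MP: "classical_modal_logic S \<Longrightarrow> Imp \<phi> \<psi> \<in> S \<Longrightarrow> \<phi> \<in> S \<Longrightarrow> \<psi> \<in> S"
  unfolding classical_modal_logic_def by meson

lemma logic_US: "classical_modal_logic S \<Longrightarrow> \<phi> \<in> S \<Longrightarrow> subst \<sigma> \<phi> \<in> S"
  unfolding classical_modal_logic_def by meson

lemma logic_RE: "classical_modal_logic S \<Longrightarrow> Iff \<phi> \<psi> \<in> S \<Longrightarrow> Iff (Dia \<phi>) (Dia \<psi>) \<in> S"
  unfolding classical_modal_logic_def by meson

text \<open>Premises are moved one at a time into an implication and discharged by modus ponens;
  with none left, the claim is a tautology. Boolean steps thereby reduce to truth values, with
  diamond formulas as atoms.\<close>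

lemma logic_tautological_consequence:
  assumes "classical_modal_logic S" "set \<gamma>s \<subseteq> S"
    and "\<forall>V M. (\<forall>\<gamma>\<in>set \<gamma>s. bval V M \<gamma>) \<longrightarrow> bval V M \<phi>"
  shows "\<phi> \<in> S"
  using assms(2,3)
proof (induction \<gamma>s arbitrary: \<phi>)
  case Nil
  then have "\<phi> \<in> logic_E"
    by (intro logic_E.taut) (simp add: tautology_def)
  then show ?case
    using assms(1) by (rule E_subset_logic[rotated])
next
  case (Cons \<gamma> \<gamma>s)
  have "Imp \<gamma> \<phi> \<in> S"
    using Cons.prems by (intro Cons.IH) auto
  moreover have "\<gamma> \<in> S"
    using Cons.prems(1) by simp
  ultimately show ?case
    by (rule logic_MP[OF assms(1)])
qed

lemma logic_consequence1:
  assumes "classical_modal_logic S" "\<alpha> \<in> S" "\<And>V M. bval V M \<alpha> \<Longrightarrow> bval V M \<phi>"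
  shows "\<phi> \<in> S"
  using assms by (intro logic_tautological_consequence[of S "[\<alpha>]"]) auto

lemma logic_consequence2:
  assumes "classical_modal_logic S" "\<alpha> \<in> S" "\<beta> \<in> S"
    and "\<And>V M. bval V M \<alpha> \<Longrightarrow> bval V M \<beta> \<Longrightarrow> bval V M \<phi>"
  shows "\<phi> \<in> S"
  using assms by (intro logic_tautological_consequence[of S "[\<alpha>, \<beta>]"]) auto

lemmas E_consequence1 = logic_consequence1[OF classical_modal_logic_E]
lemmas E_consequence2 = logic_consequence2[OF classical_modal_logic_E]

lemma Imp_E_mem_logic:
  assumes "classical_modal_logic S" "Imp \<phi> \<psi> \<in> logic_E" "\<phi> \<in> S"
  shows "\<psi> \<in> S"
  using assms(1) E_subset_logic[OF assms(1,2)] assms(3) by (rule logic_MP)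

lemma Imp_E_trans: "Imp \<phi> \<psi> \<in> logic_E \<Longrightarrow> Imp \<psi> \<theta> \<in> logic_E \<Longrightarrow> Imp \<phi> \<theta> \<in> logic_E"
  by (erule (1) E_consequence2) auto

lemma E_equiv_iff_Imp: "\<phi> \<approx>\<^sub>E \<psi> \<longleftrightarrow> Imp \<phi> \<psi> \<in> logic_E \<and> Imp \<psi> \<phi> \<in> logic_E"
proof -
  have "Iff \<phi> \<psi> \<in> logic_E \<Longrightarrow> Imp \<phi> \<psi> \<in> logic_E"
    by (erule E_consequence1) auto
  moreover have "Iff \<phi> \<psi> \<in> logic_E \<Longrightarrow> Imp \<psi> \<phi> \<in> logic_E"
    by (erule E_consequence1) auto
  moreover have "Imp \<phi> \<psi> \<in> logic_E \<Longrightarrow> Imp \<psi> \<phi> \<in> logic_E \<Longrightarrow> Iff \<phi> \<psi> \<in> logic_E"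
    by (erule (1) E_consequence2) auto
  ultimately show ?thesis
    unfolding E_equiv_def by satx
qed

lemma bval_eq_E_equiv: "(\<And>V M. bval V M \<phi> = bval V M \<psi>) \<Longrightarrow> \<phi> \<approx>\<^sub>E \<psi>"
  unfolding E_equiv_def by (rule logic_E.taut) (simp add: tautology_def)

lemma E_equiv_refl [simp]: "\<phi> \<approx>\<^sub>E \<phi>"
  by (rule bval_eq_E_equiv) simp

lemma E_equiv_sym: "\<phi> \<approx>\<^sub>E \<psi> \<Longrightarrow> \<psi> \<approx>\<^sub>E \<phi>"
  by (simp add: E_equiv_iff_Imp)

lemma E_equiv_trans [trans]: "\<phi> \<approx>\<^sub>E \<psi> \<Longrightarrow> \<psi> \<approx>\<^sub>E \<theta> \<Longrightarrow> \<phi> \<approx>\<^sub>E \<theta>"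
  unfolding E_equiv_iff_Imp by (metis Imp_E_trans)

lemma E_equiv_Neg: "\<phi> \<approx>\<^sub>E \<psi> \<Longrightarrow> Neg \<phi> \<approx>\<^sub>E Neg \<psi>"
  unfolding E_equiv_def by (erule E_consequence1) auto

lemma E_equiv_Or: "\<phi> \<approx>\<^sub>E \<psi> \<Longrightarrow> \<phi>' \<approx>\<^sub>E \<psi>' \<Longrightarrow> Or \<phi> \<phi>' \<approx>\<^sub>E Or \<psi> \<psi>'"
  unfolding E_equiv_def by (erule (1) E_consequence2) auto

lemma E_equiv_Dia: "\<phi> \<approx>\<^sub>E \<psi> \<Longrightarrow> Dia \<phi> \<approx>\<^sub>E Dia \<psi>"
  unfolding E_equiv_def by (rule logic_E.RE)

lemma E_equiv_mem_logic_iff: "classical_modal_logic S \<Longrightarrow> \<phi> \<approx>\<^sub>E \<psi> \<Longrightarrow> \<phi> \<in> S \<longleftrightarrow> \<psi> \<in> S"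
  by (meson E_equiv_iff_Imp Imp_E_mem_logic)

text \<open>Each closure condition passes to intersections; the empty family yields the set of all
  formulas, which is again a classical modal logic.\<close>

lemma classical_modal_logic_Inter:
  assumes "\<And>S. S \<in> \<S> \<Longrightarrow> classical_modal_logic S"
  shows "classical_modal_logic (\<Inter>\<S>)"
  unfolding classical_modal_logic_def
proof (intro conjI allI impI)
  show "logic_E \<subseteq> \<Inter>\<S>"
    using assms E_subset_logic by blast
  show "\<psi> \<in> \<Inter>\<S>" if "\<phi> \<in> \<Inter>\<S>" "Imp \<phi> \<psi> \<in> \<Inter>\<S>" for \<phi> \<psi>
    using that assms by (meson InterD InterI logic_MP)
  show "subst \<sigma> \<phi> \<in> \<Inter>\<S>" if "\<phi> \<in> \<Inter>\<S>" for \<phi> \<sigma>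
    using that assms by (meson InterD InterI logic_US)
  show "Iff (Dia \<phi>) (Dia \<psi>) \<in> \<Inter>\<S>" if "Iff \<phi> \<psi> \<in> \<Inter>\<S>" for \<phi> \<psi>
    using that assms by (meson InterD InterI logic_RE)
qed

section \<open>Substitution and replacement\<close>

lemma subst_subst: "subst \<sigma> (subst \<tau> \<phi>) = subst (\<lambda>i. subst \<sigma> (\<tau> i)) \<phi>"
  by (induction \<phi>) auto

lemma subst_cong: "(\<And>i. i \<in> vars \<phi> \<Longrightarrow> \<sigma> i = \<tau> i) \<Longrightarrow> subst \<sigma> \<phi> = subst \<tau> \<phi>"
  by (induction \<phi>) auto

lemma vars_subst: "vars (subst \<sigma> \<phi>) = (\<Union>i\<in>vars \<phi>. vars (\<sigma> i))"
  by (induction \<phi>) auto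

lemma mdeg_subst_le: "(\<And>i. i \<in> vars \<phi> \<Longrightarrow> mdeg (\<sigma> i) \<le> n) \<Longrightarrow> mdeg (subst \<sigma> \<phi>) \<le> mdeg \<phi> + n"
  by (induction \<phi>) (auto simp: max_def intro: order_trans)

text \<open>RE of \<open>S\<close> handles the diamond, propositional reasoning the rest. The
  equivalences live in \<open>S\<close> rather than in \<open>logic_E\<close>, because RE for a
  pulled-back logic starts from an equivalence in \<open>S\<close>.\<close>

lemma logic_subst_cong:
  assumes "classical_modal_logic S" "\<And>i. Iff (\<sigma> i) (\<tau> i) \<in> S"
  shows "Iff (subst \<sigma> \<phi>) (subst \<tau> \<phi>) \<in> S"
proof (induction \<phi>)
  case (Neg \<phi>)
  then show ?case by (rule logic_consequence1[OF assms(1)]) auto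
next
  case (Or \<phi> \<psi>)
  then show ?case by (rule logic_consequence2[OF assms(1)]) auto
next
  case (Dia \<phi>)
  then show ?case by (simp add: logic_RE[OF assms(1)])
qed (auto intro: assms logic_tautological_consequence[OF assms(1), of "[]"])

text \<open>This is the rule RE for the operator that \<rho> puts in place of the diamond.\<close>

lemma logic_replacement_cong:
  assumes "classical_modal_logic S" "Iff \<phi> \<psi> \<in> S"
  shows "Iff (subst (Var(0 := \<phi>)) \<rho>) (subst (Var(0 := \<psi>)) \<rho>) \<in> S"
proof (rule logic_subst_cong[OF assms(1)])
  fix i
  have "Iff (Var i) (Var i) \<in> S"
    using E_equiv_refl[of "Var i"] unfolding E_equiv_def by (rule E_subset_logic[OF assms(1)])
  then show "Iff ((Var(0 := \<phi>)) i) ((Var(0 := \<psi>)) i) \<in> S"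
    using assms(2) by (cases "i = 0") auto
qed

lemma E_equiv_subst: "\<phi> \<approx>\<^sub>E \<psi> \<Longrightarrow> subst \<sigma> \<phi> \<approx>\<^sub>E subst \<sigma> \<psi>"
  unfolding E_equiv_def by (drule logic_E.US[of _ \<sigma>]) simp

text \<open>In the diamond case both sides substitute into \<rho> and need agree only on
  \<open>e\<close>; any other variable of \<rho> would be caught by \<sigma>.\<close>

lemma subst_replace:
  assumes "vars \<rho> \<subseteq> {0}"
  shows "subst \<sigma> \<phi> \<star> \<rho> = subst (\<lambda>i. \<sigma> i \<star> \<rho>) (\<phi> \<star> \<rho>)"
proof (induction \<phi>)
  case (Dia \<phi>)
  then show ?case
    using assms by (auto simp: subst_subst intro!: subst_cong)
qed auto

text \<open>Reduces cancellation of two replacements to one formula: it suffices that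
  \<open>\<rho> \<star> \<rho>'\<close> is equivalent to \<open>Dia e_var\<close>.\<close>

lemma replace_replace:
  assumes "vars \<rho>' \<subseteq> {0}"
  shows "\<phi> \<star> \<rho> \<star> \<rho>' = \<phi> \<star> (\<rho> \<star> \<rho>')"
proof (induction \<phi>)
  case (Dia \<phi>)
  have "(\<lambda>i. (Var(0 := \<phi> \<star> \<rho>)) i \<star> \<rho>') = Var(0 := \<phi> \<star> (\<rho> \<star> \<rho>'))"
    using Dia by auto
  then show ?case
    by (simp add: subst_replace[OF assms])
qed auto

text \<open>\<open>Dia e_var\<close> is the identity replacement. Uniform substitution carries the
  equivalence from \<open>e\<close> to \<open>\<phi> \<star> \<rho>\<close>, and RE brings the
  induction hypothesis under the diamond.\<close>

lemma replace_E_equiv_id: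
  assumes "\<rho> \<approx>\<^sub>E Dia e_var"
  shows "\<phi> \<star> \<rho> \<approx>\<^sub>E \<phi>"
proof (induction \<phi>)
  case (Dia \<phi>)
  have "Dia \<phi> \<star> \<rho> \<approx>\<^sub>E Dia (\<phi> \<star> \<rho>)"
    using E_equiv_subst[OF assms, of "Var(0 := \<phi> \<star> \<rho>)"] by simp
  also have "\<dots> \<approx>\<^sub>E Dia \<phi>"
    using Dia by (rule E_equiv_Dia)
  finally show ?case .
qed (auto intro: E_equiv_Neg E_equiv_Or)

text \<open>Replacement is absorbed into the valuation of the diamond atoms, so it preserves
  tautologies.\<close>

lemma bval_replace: "bval V M (\<phi> \<star> \<rho>) = bval V (\<lambda>\<psi>. bval V M (Dia \<psi> \<star> \<rho>)) \<phi>"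
  by (induction \<phi>) auto

lemma replace_mem_E:
  assumes "vars \<rho> \<subseteq> {0}" "\<phi> \<in> logic_E"
  shows "\<phi> \<star> \<rho> \<in> logic_E"
  using assms(2)
proof induction
  case (taut \<phi>)
  then show ?case
    by (intro logic_E.taut) (simp add: tautology_def bval_replace[of _ _ \<phi>])
next
  case (MP \<phi> \<psi>)
  then show ?case
    by (auto intro: logic_E.MP)
next
  case (US \<phi> \<sigma>)
  then show ?case
    by (simp add: subst_replace[OF assms(1)] logic_E.US)
next
  case (RE \<phi> \<psi>)
  then show ?case
    by (simp add: logic_replacement_cong[OF classical_modal_logic_E])
qed

text \<open>Each closure condition of the preimage is the matching condition of \<open>S\<close>,
  with RE becoming congruence of the context \<rho>.\<close>

lemma classical_modal_logic_replace:
  assumes S: "classical_modal_logic S" and \<rho>: "vars \<rho> \<subseteq> {0}"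
  shows "classical_modal_logic {\<phi>. \<phi> \<star> \<rho> \<in> S}"
  unfolding classical_modal_logic_def mem_Collect_eq
proof (intro conjI allI impI)
  show "logic_E \<subseteq> {\<phi>. \<phi> \<star> \<rho> \<in> S}"
    using replace_mem_E[OF \<rho>] E_subset_logic[OF S] by blast
  show "\<psi> \<star> \<rho> \<in> S" if "\<phi> \<star> \<rho> \<in> S" "Imp \<phi> \<psi> \<star> \<rho> \<in> S" for \<phi> \<psi>
    using logic_MP[OF S, of "\<phi> \<star> \<rho>"] that by simp
  show "subst \<sigma> \<phi> \<star> \<rho> \<in> S" if "\<phi> \<star> \<rho> \<in> S" for \<phi> \<sigma>
    using that by (simp add: subst_replace[OF \<rho>] logic_US[OF S])
  show "Iff (Dia \<phi>) (Dia \<psi>) \<star> \<rho> \<in> S" if "Iff \<phi> \<psi> \<star> \<rho> \<in> S" for \<phi> \<psi>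
    using that by (simp add: logic_replacement_cong[OF S])
qed

text \<open>Degree at most 1 trades each diamond for at most one level of diamonds, and \<rho>
  brings in no variable besides \<open>e\<close>, which is substituted away.\<close>

lemma replace_mem_forms:
  assumes "\<rho> \<in> uniform_replacements" "\<phi> \<in> forms v d"
  shows "\<phi> \<star> \<rho> \<in> forms v d"
proof -
  have \<rho>: "vars \<rho> \<subseteq> {0}" "mdeg \<rho> \<le> 1"
    using assms(1) by (auto simp: uniform_replacements_def)
  have "vars (\<phi> \<star> \<rho>) \<subseteq> vars \<phi>"
  proof (induction \<phi>)
    case (Dia \<phi>)
    then show ?case using \<rho>(1) by (auto simp: vars_subst split: if_splits)
  qed auto
  moreover have "mdeg (\<phi> \<star> \<rho>) \<le> mdeg \<phi>"
  proof (induction \<phi>)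
    case (Dia \<phi>)
    have "mdeg (subst (Var(0 := \<phi> \<star> \<rho>)) \<rho>) \<le> mdeg \<rho> + mdeg \<phi>"
      using Dia by (intro mdeg_subst_le) auto
    then show ?case using \<rho>(2) by simp
  qed auto
  ultimately show ?thesis
    using assms(2) by (auto simp: forms_def)
qed

section \<open>Invertibility of the replacements in \<open>\<R>\<^sub>p(1)\<close>\<close>

text \<open>Every atom \<open>\<diamond>\<psi>\<close> other than \<open>\<diamond>e\<close> is read as \<open>\<diamond>\<not>e\<close>, the only other one that occurs in
  \<open>\<R>\<^sub>p(1)\<close>.\<close>

definition truth_fn :: "fm \<Rightarrow> bool \<Rightarrow> bool \<Rightarrow> bool \<Rightarrow> bool" where
  "truth_fn \<rho> a x y = bval (\<lambda>_. a) (\<lambda>\<psi>. if \<psi> = e_var then x else y) \<rho>"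

text \<open>The only diamond atoms in \<open>R_p1\<close> are those of \<open>e\<close> and its
  negation, and substitution turns them into \<open>Dia \<psi>\<close> and
  \<open>Dia (Neg \<psi>)\<close>.\<close>

lemma bval_replacement:
  assumes "\<rho> \<in> R_p1"
  shows "bval V M (subst (Var(0 := \<psi>)) \<rho>) = truth_fn \<rho> (bval V M \<psi>) (M \<psi>) (M (Neg \<psi>))"
  using assms unfolding R_p1_def by (auto simp: truth_fn_def)

lemma bval_R_p1:
  assumes "\<rho> \<in> R_p1"
  shows "bval V M \<rho> = truth_fn \<rho> (V 0) (M e_var) (M (Neg e_var))"
  using assms unfolding R_p1_def by (auto simp: truth_fn_def)

text \<open>Let \<open>a\<close>, \<open>x\<close>, \<open>y\<close> be the values of
  \<open>e\<close>, \<open>Dia e_var\<close>, \<open>Dia (Neg e_var)\<close>. Replacing the latter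
  diamond means evaluating at the negation of \<open>e\<close>, which flips \<open>a\<close> and
  swaps \<open>x\<close> and \<open>y\<close> up to double negation. Recovering \<open>x\<close> for
  all arguments therefore recovers \<open>y\<close> too.\<close>

lemma truth_fn_inverse:
  assumes "\<rho> \<in> R_p1"
  shows "\<exists>\<rho>'\<in>R_p1. \<forall>a x y.
    truth_fn \<rho> a (truth_fn \<rho>' a x y) (truth_fn \<rho>' (\<not> a) y x) = x \<and>
    truth_fn \<rho>' a (truth_fn \<rho> a x y) (truth_fn \<rho> (\<not> a) y x) = x"
proof -
  define x y where "x = Dia e_var" and "y = Dia (Neg e_var)"
  \<comment> \<open>Mutually inverse replacements, each pair in one orientation: 10 self-inverse
    ones and 7 proper pairs, as in the symmetric group on four letters.\<close>
  define P where "P =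
    {(Iff x Tru, Iff x Tru), (Iff x e_var, Iff x e_var),
     (Iff x (Or e_var y), Iff x (Or e_var y)),
     (Iff x (Or e_var (Neg y)), Iff x (Or e_var (Neg y))),
     (Iff x (Or (Neg e_var) y), Iff x (Or (Neg e_var) y)),
     (Iff x (Or (Neg e_var) (Neg y)), Iff x (Or (Neg e_var) (Neg y))),
     (Iff (Neg x) Tru, Iff (Neg x) Tru), (Iff (Neg x) e_var, Iff (Neg x) e_var),
     (Iff (Neg x) (Or e_var y), Iff (Neg x) (Or e_var (Neg y))),
     (Iff (Neg x) (Or (Neg e_var) y), Iff (Neg x) (Or (Neg e_var) (Neg y))),
     (Iff y Tru, Iff y Tru), (Iff y e_var, Iff (Neg y) e_var),
     (Iff y (Or e_var x), Iff y (Or (Neg e_var) x)),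
     (Iff y (Or e_var (Neg x)), Iff y (Or (Neg e_var) (Neg x))),
     (Iff (Neg y) Tru, Iff (Neg y) Tru),
     (Iff (Neg y) (Or e_var x), Iff (Neg y) (Or (Neg e_var) (Neg x))),
     (Iff (Neg y) (Or e_var (Neg x)), Iff (Neg y) (Or (Neg e_var) x))}"
  have "\<exists>\<rho>'. (\<rho>, \<rho>') \<in> P \<or> (\<rho>', \<rho>) \<in> P"
    using assms unfolding R_p1_def P_def x_def y_def
    by (elim UnE CollectE exE conjE insertE emptyE; hypsubst) (simp_all add: ex_disj_distrib)
  moreover have "\<sigma> \<in> R_p1 \<and> \<tau> \<in> R_p1" if "(\<sigma>, \<tau>) \<in> P" for \<sigma> \<tau>
    using that unfolding R_p1_def P_def x_def y_def
    by (elim insertE emptyE; simp only: prod.inject; elim conjE; hypsubst)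
      (simp_all add: conj_disj_distribR ex_disj_distrib)
  moreover have "truth_fn \<sigma> a (truth_fn \<tau> a u w) (truth_fn \<tau> (\<not> a) w u) = u \<and>
      truth_fn \<tau> a (truth_fn \<sigma> a u w) (truth_fn \<sigma> (\<not> a) w u) = u"
    if "(\<sigma>, \<tau>) \<in> P" for \<sigma> \<tau> a u w
    using that unfolding P_def x_def y_def
    by (elim insertE emptyE; simp only: prod.inject; elim conjE; hypsubst)
      (cases a; cases u; cases w; simp add: truth_fn_def)+
  ultimately show ?thesis
    by metis
qed

lemma replace_R_p1_inverse:
  assumes "\<rho> \<in> R_p1" "\<rho>' \<in> R_p1"
    and "\<And>a x y. truth_fn \<rho> a (truth_fn \<rho>' a x y) (truth_fn \<rho>' (\<not> a) y x) = x"
  shows "\<phi> \<star> \<rho> \<star> \<rho>' \<approx>\<^sub>E \<phi>"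
proof -
  \<comment> \<open>The composite may contain \<open>Dia (Neg (Neg e_var))\<close>, which Boolean
    evaluation treats as unrelated to \<open>Dia e_var\<close>. RE identifies the two, and this
    equivalence serves as the premise of an otherwise Boolean argument.\<close>
  have "Iff (Dia (Neg (Neg e_var))) (Dia e_var) \<in> logic_E"
    using E_equiv_Dia[OF bval_eq_E_equiv, of "Neg (Neg e_var)" e_var] by (simp add: E_equiv_def)
  then have "\<rho> \<star> \<rho>' \<approx>\<^sub>E Dia e_var"
    unfolding E_equiv_def
  proof (rule E_consequence1)
    fix V M
    assume "bval V M (Iff (Dia (Neg (Neg e_var))) (Dia e_var))"
    then have [simp]: "M (Neg (Neg e_var)) = M e_var"
      by auto
    have "bval V M (\<rho> \<star> \<rho>') = M e_var"
      using assms by (simp add: bval_replace[of _ _ \<rho>] bval_R_p1[OF assms(1)] bval_replacement)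
    then show "bval V M (Iff (\<rho> \<star> \<rho>') (Dia e_var))"
      by simp
  qed
  moreover have "vars \<rho>' \<subseteq> {0}"
    using assms(2) R_p1_uniform_replacements by (auto simp: uniform_replacements_def)
  ultimately show ?thesis
    by (simp add: replace_replace replace_E_equiv_id)
qed

section \<open>Finiteness of \<open>\<^bold>E[v,d]\<close>\<close>

primrec atoms :: "fm \<Rightarrow> fm set" where
  "atoms Fls = {}"
| "atoms Tru = {}"
| "atoms (Var i) = {Var i}"
| "atoms (Neg \<phi>) = atoms \<phi>"
| "atoms (Or \<phi> \<psi>) = atoms \<phi> \<union> atoms \<psi>"
| "atoms (Dia \<phi>) = {Dia \<phi>}"

lemma atoms_subset_forms: "atoms \<phi> \<subseteq> forms v d \<Longrightarrow> \<phi> \<in> forms v d"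
  by (induction \<phi>) (auto simp: forms_def)

text \<open>A Boolean combination of \<open>A\<close> is fixed up to equivalence by its set of
  satisfying assignments, and there are finitely many such sets. \<open>R\<close> picks one formula
  for each set that occurs.\<close>

lemma finite_Boolean_combinations:
  assumes "finite A"
  obtains R where "finite R" "\<And>\<phi>. \<phi> \<in> R \<Longrightarrow> atoms \<phi> \<subseteq> A"
    "\<And>\<phi>. atoms \<phi> \<subseteq> A \<Longrightarrow> \<exists>\<psi>\<in>R. \<phi> \<approx>\<^sub>E \<psi>"
proof -
  \<comment> \<open>An assignment is encoded as the set \<open>B\<close> of atoms it makes
    true.\<close>
  define val where "val B = bval (\<lambda>i. Var i \<in> B) (\<lambda>\<psi>. Dia \<psi> \<in> B)" for B
  define models where "models \<phi> = {B \<in> Pow A. val B \<phi>}" for \<phi>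
  define X where "X = {\<phi>. atoms \<phi> \<subseteq> A}"
  have "finite (models ` X)"
    by (rule finite_subset[of _ "Pow (Pow A)"]) (use assms in \<open>auto simp: models_def\<close>)
  then obtain R where R: "R \<subseteq> X" "finite R" "models ` X = models ` R"
    by (metis finite_subset_image subset_refl)
  have val_eq: "bval V M \<phi> = val {\<alpha> \<in> A. bval V M \<alpha>} \<phi>" if "\<phi> \<in> X" for V M \<phi>
    using that unfolding X_def val_def by (induction \<phi>) auto
  have "\<phi> \<approx>\<^sub>E \<psi>" if "\<phi> \<in> X" "\<psi> \<in> X" "models \<phi> = models \<psi>" for \<phi> \<psi>
  proof (rule bval_eq_E_equiv)
    fix V M
    have "{\<alpha> \<in> A. bval V M \<alpha>} \<in> models \<phi> \<longleftrightarrow> {\<alpha> \<in> A. bval V M \<alpha>} \<in> models \<psi>"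
      using that(3) by simp
    then show "bval V M \<phi> = bval V M \<psi>"
      using that(1,2) by (simp add: models_def val_eq)
  qed
  moreover have "\<exists>\<psi>\<in>R. models \<phi> = models \<psi>" if "\<phi> \<in> X" for \<phi>
    using that R(3) by blast
  ultimately have "\<exists>\<psi>\<in>R. \<phi> \<approx>\<^sub>E \<psi>" if "\<phi> \<in> X" for \<phi>
    using that R(1) by (meson subsetD)
  then show ?thesis
    using R(1,2) that unfolding X_def by blast
qed

text \<open>Induction on the degree: by RE the arguments of the outermost diamonds may be taken from
  finitely many representatives of lower degree, leaving Boolean combinations of finitely many
  atoms.\<close>

lemma finite_representatives:
  obtains R where "finite R" "R \<subseteq> forms v d" "\<And>\<phi>. \<phi> \<in> forms v d \<Longrightarrow> \<exists>\<psi>\<in>R. \<phi> \<approx>\<^sub>E \<psi>"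
proof -
  have "\<exists>R. finite R \<and> R \<subseteq> forms v d \<and> (\<forall>\<phi>\<in>forms v d. \<exists>\<psi>\<in>R. \<phi> \<approx>\<^sub>E \<psi>)"
  proof (induction d)
    case 0
    obtain R where R: "finite R" "\<And>\<phi>. \<phi> \<in> R \<Longrightarrow> atoms \<phi> \<subseteq> Var ` {..<v}"
        "\<And>\<phi>. atoms \<phi> \<subseteq> Var ` {..<v} \<Longrightarrow> \<exists>\<psi>\<in>R. \<phi> \<approx>\<^sub>E \<psi>"
      using finite_Boolean_combinations[of "Var ` {..<v}"] by blast
    have "atoms \<phi> \<subseteq> Var ` {..<v}" if "\<phi> \<in> forms v 0" for \<phi>
      using that unfolding forms_def by (induction \<phi>) auto
    moreover have "\<phi> \<in> forms v 0" if "\<phi> \<in> R" for \<phi>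
      using R(2)[OF that] by (intro atoms_subset_forms) (auto simp: forms_def)
    ultimately show ?case
      using R(1,3) by (intro exI[of _ R]) auto
  next
    case (Suc d)
    then obtain Q where Q: "finite Q" "Q \<subseteq> forms v d" "\<And>\<phi>. \<phi> \<in> forms v d \<Longrightarrow> \<exists>\<psi>\<in>Q. \<phi> \<approx>\<^sub>E \<psi>"
      by auto
    define A where "A = Var ` {..<v} \<union> Dia ` Q"
    obtain R where R: "finite R" "\<And>\<phi>. \<phi> \<in> R \<Longrightarrow> atoms \<phi> \<subseteq> A"
        "\<And>\<phi>. atoms \<phi> \<subseteq> A \<Longrightarrow> \<exists>\<psi>\<in>R. \<phi> \<approx>\<^sub>E \<psi>"
      using finite_Boolean_combinations[of A] Q(1) by (auto simp: A_def)
    have to_A: "\<exists>\<psi>. atoms \<psi> \<subseteq> A \<and> \<phi> \<approx>\<^sub>E \<psi>" if "\<phi> \<in> forms v (Suc d)" for \<phi>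
      using that
    proof (induction \<phi>)
      case (Neg \<phi>)
      then obtain \<psi> where "atoms \<psi> \<subseteq> A" "\<phi> \<approx>\<^sub>E \<psi>"
        by (auto simp: forms_def)
      then show ?case
        by (intro exI[of _ "Neg \<psi>"]) (simp add: E_equiv_Neg)
    next
      case (Or \<phi>\<^sub>1 \<phi>\<^sub>2)
      then obtain \<psi>\<^sub>1 \<psi>\<^sub>2 where "atoms \<psi>\<^sub>1 \<subseteq> A" "\<phi>\<^sub>1 \<approx>\<^sub>E \<psi>\<^sub>1" "atoms \<psi>\<^sub>2 \<subseteq> A" "\<phi>\<^sub>2 \<approx>\<^sub>E \<psi>\<^sub>2"
        by (auto simp: forms_def)
      then show ?case
        by (intro exI[of _ "Or \<psi>\<^sub>1 \<psi>\<^sub>2"]) (simp add: E_equiv_Or)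
    next
      case (Dia \<phi>)
      then obtain \<psi> where "\<psi> \<in> Q" "\<phi> \<approx>\<^sub>E \<psi>"
        using Q(3)[of \<phi>] by (auto simp: forms_def)
      then show ?case
        by (intro exI[of _ "Dia \<psi>"]) (simp add: E_equiv_Dia A_def)
    next
      case Fls
      show ?case by (rule exI[of _ Fls]) simp
    next
      case Tru
      show ?case by (rule exI[of _ Tru]) simp
    next
      case (Var i)
      then show ?case by (intro exI[of _ "Var i"]) (auto simp: A_def forms_def)
    qed
    have "A \<subseteq> forms v (Suc d)"
      using Q(2) by (fastforce simp: A_def forms_def)
    then have "R \<subseteq> forms v (Suc d)"
      using R(2) atoms_subset_forms by blast
    moreover have "\<exists>\<psi>\<in>R. \<phi> \<approx>\<^sub>E \<psi>" if "\<phi> \<in> forms v (Suc d)" for \<phi>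
      using to_A[OF that] R(3) E_equiv_trans by blast
    ultimately show ?case
      using R(1) by blast
  qed
  then show ?thesis
    using that by blast
qed

section \<open>Characteristic minmatrices\<close>

lemma bval_Conj: "bval V M (Conj \<phi>s) \<longleftrightarrow> (\<forall>\<phi>\<in>set \<phi>s. bval V M \<phi>)"
  by (induction \<phi>s) auto

lemma Conj_mem_forms: "set \<phi>s \<subseteq> forms v d \<Longrightarrow> Conj \<phi>s \<in> forms v d"
  by (induction \<phi>s) (auto simp: forms_def)

lemma theorem_list:
  "set (theorem_list S v d) \<subseteq> S \<inter> forms v d \<and>
   (\<forall>\<phi>\<in>S \<inter> forms v d. \<exists>\<psi>\<in>set (theorem_list S v d). \<phi> \<approx>\<^sub>E \<psi>)"
proof -
  obtain R where R: "finite R" "R \<subseteq> forms v d" "\<And>\<phi>. \<phi> \<in> forms v d \<Longrightarrow> \<exists>\<psi>\<in>R. \<phi> \<approx>\<^sub>E \<psi>"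
    using finite_representatives by blast
  define X where "X = S \<inter> forms v d"
  \<comment> \<open>\<open>S\<close> is an arbitrary set here, so representatives in
    \<open>R\<close> may lie outside it. They only label the classes; the list itself is drawn from
    \<open>X\<close>.\<close>
  define cls where "cls \<phi> = {\<psi> \<in> R. \<phi> \<approx>\<^sub>E \<psi>}" for \<phi>
  have "finite (cls ` X)"
    by (rule finite_subset[of _ "Pow R"]) (use R(1) in \<open>auto simp: cls_def\<close>)
  then obtain Y where Y: "Y \<subseteq> X" "finite Y" "cls ` X = cls ` Y"
    by (metis finite_subset_image subset_refl)
  obtain \<phi>s where \<phi>s: "set \<phi>s = Y"
    using finite_list[OF Y(2)] by blast
  have "\<exists>\<psi>\<in>Y. \<phi> \<approx>\<^sub>E \<psi>" if "\<phi> \<in> X" for \<phi>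
  proof -
    obtain \<psi> where \<psi>: "\<psi> \<in> Y" "cls \<phi> = cls \<psi>"
      using Y(3) \<open>\<phi> \<in> X\<close> by blast
    obtain \<theta> where "\<theta> \<in> cls \<phi>"
      using R(3)[of \<phi>] \<open>\<phi> \<in> X\<close> by (auto simp: X_def cls_def)
    with \<psi> have "\<phi> \<approx>\<^sub>E \<theta>" "\<psi> \<approx>\<^sub>E \<theta>"
      by (auto simp: cls_def)
    then show ?thesis
      using \<psi>(1) E_equiv_sym E_equiv_trans by blast
  qed
  then have "set \<phi>s \<subseteq> S \<inter> forms v d \<and> (\<forall>\<phi>\<in>S \<inter> forms v d. \<exists>\<psi>\<in>set \<phi>s. \<phi> \<approx>\<^sub>E \<psi>)"
    using Y(1) \<phi>s by (auto simp: X_def)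
  then show ?thesis
    unfolding theorem_list_def by (rule someI)
qed

text \<open>Closure under finite conjunction gives membership; every theorem in
  \<open>forms v d\<close> is equivalent to a conjunct, so the conjunction is a strongest
  one.\<close>

lemma Conj_theorem_list:
  assumes "classical_modal_logic S"
  shows "Conj (theorem_list S v d) \<in> S \<inter> forms v d"
    and "\<phi> \<in> S \<inter> forms v d \<Longrightarrow> Imp (Conj (theorem_list S v d)) \<phi> \<in> logic_E"
proof -
  have sub: "set (theorem_list S v d) \<subseteq> S \<inter> forms v d"
    using theorem_list by blast
  then show "Conj (theorem_list S v d) \<in> S \<inter> forms v d"
    by (intro IntI logic_tautological_consequence[OF assms, of "theorem_list S v d"] Conj_mem_forms)
      (simp_all add: bval_Conj)
  assume "\<phi> \<in> S \<inter> forms v d"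
  then obtain \<psi> where \<psi>: "\<psi> \<in> set (theorem_list S v d)" "\<phi> \<approx>\<^sub>E \<psi>"
    using theorem_list by blast
  from \<psi>(2) show "Imp (Conj (theorem_list S v d)) \<phi> \<in> logic_E"
    unfolding E_equiv_def by (rule E_consequence1) (use \<psi>(1) in \<open>auto simp: bval_Conj\<close>)
qed

text \<open>Describes the minmatrix as the strongest theorems of \<open>S\<close> in
  \<open>forms v d\<close>, which removes the dependence on the chosen list.\<close>

lemma mem_char_minmatrix_iff:
  assumes "classical_modal_logic S"
  shows "\<chi> \<in> char_minmatrix S v d \<longleftrightarrow>
    \<chi> \<in> S \<inter> forms v d \<and> (\<forall>\<phi>\<in>S \<inter> forms v d. Imp \<chi> \<phi> \<in> logic_E)"
proof -
  let ?C = "Conj (theorem_list S v d)"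
  note C = Conj_theorem_list[OF assms, where v = v and d = d]
  have "\<chi> \<in> char_minmatrix S v d \<longleftrightarrow>
      \<chi> \<in> forms v d \<and> Imp ?C \<chi> \<in> logic_E \<and> Imp \<chi> ?C \<in> logic_E"
    using C(1) by (simp only: char_minmatrix_def E_rel_def Image_singleton_iff mem_Collect_eq
        case_prod_conv E_equiv_iff_Imp) blast
  also have "\<dots> \<longleftrightarrow> \<chi> \<in> S \<inter> forms v d \<and> (\<forall>\<phi>\<in>S \<inter> forms v d. Imp \<chi> \<phi> \<in> logic_E)"
    using C Imp_E_mem_logic[OF assms, of ?C \<chi>] Imp_E_trans[of \<chi> ?C] by blast
  finally show ?thesis .
qed

lemma char_minmatrix_nonempty:
  assumes "classical_modal_logic S"
  obtains \<chi> where "\<chi> \<in> char_minmatrix S v d"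
  using Conj_theorem_list[OF assms] mem_char_minmatrix_iff[OF assms] by blast

text \<open>The order is reversed because a strongest theorem of \<open>T\<close> implies all the
  others: once \<open>S\<close> contains it, \<open>S\<close> contains every theorem of
  \<open>T\<close> in \<open>forms v d\<close>.\<close>

lemma E_le_char_minmatrix_iff:
  assumes S: "classical_modal_logic S" and T: "classical_modal_logic T"
  shows "E_le (char_minmatrix S v d) (char_minmatrix T v d) \<longleftrightarrow> T \<inter> forms v d \<subseteq> S \<inter> forms v d"
proof
  assume "E_le (char_minmatrix S v d) (char_minmatrix T v d)"
  then obtain \<chi> \<chi>' where \<chi>: "\<chi> \<in> char_minmatrix S v d" "\<chi>' \<in> char_minmatrix T v d"
      "Imp \<chi> \<chi>' \<in> logic_E"
    by (auto simp: E_le_def)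
  show "T \<inter> forms v d \<subseteq> S \<inter> forms v d"
  proof
    fix \<phi>
    assume \<phi>: "\<phi> \<in> T \<inter> forms v d"
    then have "Imp \<chi> \<phi> \<in> logic_E"
      using \<chi> Imp_E_trans mem_char_minmatrix_iff[OF T] by blast
    then show "\<phi> \<in> S \<inter> forms v d"
      using \<phi> \<chi>(1) Imp_E_mem_logic[OF S] mem_char_minmatrix_iff[OF S] by blast
  qed
next
  assume sub: "T \<inter> forms v d \<subseteq> S \<inter> forms v d"
  obtain \<chi> where \<chi>: "\<chi> \<in> char_minmatrix S v d"
    using char_minmatrix_nonempty[OF S] .
  obtain \<chi>' where \<chi>': "\<chi>' \<in> char_minmatrix T v d"
    using char_minmatrix_nonempty[OF T] .
  have "\<chi>' \<in> S \<inter> forms v d"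
    using \<chi>' sub by (auto simp: mem_char_minmatrix_iff[OF T])
  then have "Imp \<chi> \<chi>' \<in> logic_E"
    using \<chi> by (simp add: mem_char_minmatrix_iff[OF S])
  then show "E_le (char_minmatrix S v d) (char_minmatrix T v d)"
    using \<chi> \<chi>' unfolding E_le_def by (intro bexI)
qed

lemma char_minmatrix_eq_iff:
  assumes "classical_modal_logic S" "classical_modal_logic T"
  shows "char_minmatrix S v d = char_minmatrix T v d \<longleftrightarrow> S \<inter> forms v d = T \<inter> forms v d"
proof
  assume "char_minmatrix S v d = char_minmatrix T v d"
  \<comment> \<open>The instance with \<open>S\<close> twice supplies reflexivity of
    \<open>E_le\<close>, which the assumed equality turns into both comparisons.\<close>
  then show "S \<inter> forms v d = T \<inter> forms v d"
    using E_le_char_minmatrix_iff[OF assms, of v d] E_le_char_minmatrix_iff[OF assms(2,1), of v d]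
      E_le_char_minmatrix_iff[OF assms(1,1), of v d] by auto
next
  assume "S \<inter> forms v d = T \<inter> forms v d"
  then show "char_minmatrix S v d = char_minmatrix T v d"
    by (intro Set.set_eqI)
      (simp only: mem_char_minmatrix_iff[OF assms(1)] mem_char_minmatrix_iff[OF assms(2)])
qed

lemma char_minmatrix_mem: "classical_modal_logic S \<Longrightarrow> char_minmatrix S v d \<in> char_minmatrices v d"
  unfolding char_minmatrices_def by blast

lemma char_minmatricesE:
  assumes "\<xi> \<in> char_minmatrices v d"
  obtains S where "classical_modal_logic S" "\<xi> = char_minmatrix S v d"
  using assms unfolding char_minmatrices_def by blast

lemma equiv_E_rel: "equiv (forms v d) (E_rel v d)"
proof (rule equivI)
  show "sym (E_rel v d)"
    by (auto simp: E_rel_def intro!: symI dest: E_equiv_sym)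
  show "trans (E_rel v d)"
    by (rule transI) (auto simp: E_rel_def dest: E_equiv_trans)
qed (auto simp: E_rel_def refl_on_def)

lemma char_minmatrix_mem_E_quot:
  "classical_modal_logic S \<Longrightarrow> char_minmatrix S v d \<in> E_quot v d"
  unfolding char_minmatrix_def E_quot_def using Conj_theorem_list(1)[of S v d]
  by (simp add: quotientI)

lemma lattice_minmatrix_order: "lattice (minmatrix_order v d)"
proof -
  let ?L = "minmatrix_order v d"
  have po: "partial_order ?L"
  proof
    fix x y
    assume "x \<in> carrier ?L" "y \<in> carrier ?L" "x \<sqsubseteq>\<^bsub>?L\<^esub> y" "y \<sqsubseteq>\<^bsub>?L\<^esub> x"
    then show "x .=\<^bsub>?L\<^esub> y"
      by (simp add: minmatrix_order_def, elim char_minmatricesE)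
        (simp add: E_le_char_minmatrix_iff char_minmatrix_eq_iff, blast)
  next
    fix x y z
    assume "x \<in> carrier ?L" "y \<in> carrier ?L" "z \<in> carrier ?L" "x \<sqsubseteq>\<^bsub>?L\<^esub> y" "y \<sqsubseteq>\<^bsub>?L\<^esub> z"
    then show "x \<sqsubseteq>\<^bsub>?L\<^esub> z"
      by (simp add: minmatrix_order_def, elim char_minmatricesE)
        (simp add: E_le_char_minmatrix_iff, blast)
  qed (auto simp: minmatrix_order_def E_le_char_minmatrix_iff elim!: char_minmatricesE)
  have "\<exists>s. least ?L s (Upper ?L {x, y})" if xy: "x \<in> carrier ?L" "y \<in> carrier ?L" for x y
  proof -
    obtain S T where S: "classical_modal_logic S" "x = char_minmatrix S v d"
        and T: "classical_modal_logic T" "y = char_minmatrix T v d"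
      using xy by (auto simp: minmatrix_order_def elim!: char_minmatricesE)
    \<comment> \<open>Since the order is reversed, the intersection of the logics yields the least
      upper bound.\<close>
    have ST: "classical_modal_logic (S \<inter> T)"
      using classical_modal_logic_Inter[of "{S, T}"] S(1) T(1) by auto
    have "least ?L (char_minmatrix (S \<inter> T) v d) (Upper ?L {x, y})"
    proof (rule least_UpperI)
      show "u \<sqsubseteq>\<^bsub>?L\<^esub> char_minmatrix (S \<inter> T) v d" if "u \<in> {x, y}" for u
        using that S T ST by (auto simp: minmatrix_order_def E_le_char_minmatrix_iff)
      show "char_minmatrix (S \<inter> T) v d \<sqsubseteq>\<^bsub>?L\<^esub> u" if u: "u \<in> Upper ?L {x, y}" for u
      proof -
        obtain U where U: "classical_modal_logic U" "u = char_minmatrix U v d"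
          using u by (auto simp: Upper_def minmatrix_order_def elim: char_minmatricesE)
        have "E_le x u" "E_le y u"
          using u xy by (auto simp: Upper_def minmatrix_order_def)
        then have "U \<inter> forms v d \<subseteq> (S \<inter> T) \<inter> forms v d"
          using S T U by (auto simp: E_le_char_minmatrix_iff)
        then show ?thesis
          using U ST by (simp add: minmatrix_order_def E_le_char_minmatrix_iff)
      qed
    qed (use xy ST in \<open>auto simp: minmatrix_order_def char_minmatrix_mem\<close>)
    then show ?thesis ..
  qed
  moreover have "\<exists>s. greatest ?L s (Lower ?L {x, y})" if xy: "x \<in> carrier ?L" "y \<in> carrier ?L" for x y
  proof -
    obtain S T where S: "classical_modal_logic S" "x = char_minmatrix S v d"
        and T: "classical_modal_logic T" "y = char_minmatrix T v d"
      using xy by (auto simp: minmatrix_order_def elim!: char_minmatricesE)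
    text \<open>Only the theorems in \<open>\<F>(v,d)\<close> are put into the join: a logic whose minmatrix lies below
      both need not contain \<open>S\<close> or \<open>T\<close>.\<close>
    define J where "J = \<Inter>{U. classical_modal_logic U \<and> (S \<union> T) \<inter> forms v d \<subseteq> U}"
    have J: "classical_modal_logic J"
      unfolding J_def by (rule classical_modal_logic_Inter) simp
    have STJ: "(S \<union> T) \<inter> forms v d \<subseteq> J"
      unfolding J_def by blast
    have "greatest ?L (char_minmatrix J v d) (Lower ?L {x, y})"
    proof (rule greatest_LowerI)
      show "char_minmatrix J v d \<sqsubseteq>\<^bsub>?L\<^esub> u" if "u \<in> {x, y}" for u
        using that S T J STJ by (auto simp: minmatrix_order_def E_le_char_minmatrix_iff)
      show "u \<sqsubseteq>\<^bsub>?L\<^esub> char_minmatrix J v d" if u: "u \<in> Lower ?L {x, y}" for u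
      proof -
        obtain U where U: "classical_modal_logic U" "u = char_minmatrix U v d"
          using u by (auto simp: Lower_def minmatrix_order_def elim: char_minmatricesE)
        have "E_le u x" "E_le u y"
          using u xy by (auto simp: Lower_def minmatrix_order_def)
        then have "(S \<union> T) \<inter> forms v d \<subseteq> U"
          using S T U by (auto simp: E_le_char_minmatrix_iff)
        then have "J \<subseteq> U"
          using U(1) unfolding J_def by blast
        then show ?thesis
          using U J by (auto simp: minmatrix_order_def E_le_char_minmatrix_iff)
      qed
    qed (use xy J in \<open>auto simp: minmatrix_order_def char_minmatrix_mem\<close>)
    then show ?thesis ..
  qed
  ultimately show ?thesis
    using po by (simp add: lattice_def upper_semilattice_def lower_semilattice_def
        upper_semilattice_axioms_def lower_semilattice_axioms_def)
qed

section \<open>The action of replacements on minmatrices\<close>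

text \<open>By surjectivity the join of two images is itself an image \<open>f z\<close>; reflecting
  the order makes \<open>z\<close> an upper bound of the arguments, which gives the nontrivial
  inequality. Meets are dual.\<close>

lemma order_iso_lattice_automorphism:
  assumes L: "lattice L" and f: "bij_betw f (carrier L) (carrier L)"
    and le: "\<And>x y. x \<in> carrier L \<Longrightarrow> y \<in> carrier L \<Longrightarrow> f x \<sqsubseteq>\<^bsub>L\<^esub> f y \<longleftrightarrow> x \<sqsubseteq>\<^bsub>L\<^esub> y"
  shows "lattice_automorphism L f"
proof -
  interpret lattice L by (rule L)
  have f_closed: "f x \<in> carrier L" if "x \<in> carrier L" for x
    using f that by (auto simp: bij_betw_def)
  have f_surj: "\<exists>x\<in>carrier L. y = f x" if "y \<in> carrier L" for y
    using f that by (auto simp: bij_betw_def)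
  have "f (x \<squnion>\<^bsub>L\<^esub> y) = f x \<squnion>\<^bsub>L\<^esub> f y" if xy: "x \<in> carrier L" "y \<in> carrier L" for x y
  proof (rule le_antisym)
    obtain z where z: "z \<in> carrier L" "f x \<squnion>\<^bsub>L\<^esub> f y = f z"
      using f_surj xy f_closed join_closed by metis
    have "x \<sqsubseteq>\<^bsub>L\<^esub> z" "y \<sqsubseteq>\<^bsub>L\<^esub> z"
      using join_left[of "f x" "f y"] join_right[of "f x" "f y"] xy z f_closed le by metis+
    then show "f (x \<squnion>\<^bsub>L\<^esub> y) \<sqsubseteq>\<^bsub>L\<^esub> f x \<squnion>\<^bsub>L\<^esub> f y"
      using xy z by (simp add: le join_le)
  qed (use xy in \<open>auto intro!: join_le join_left join_right simp: le f_closed\<close>)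
  moreover have "f (x \<sqinter>\<^bsub>L\<^esub> y) = f x \<sqinter>\<^bsub>L\<^esub> f y" if xy: "x \<in> carrier L" "y \<in> carrier L" for x y
  proof (rule le_antisym)
    obtain z where z: "z \<in> carrier L" "f x \<sqinter>\<^bsub>L\<^esub> f y = f z"
      using f_surj xy f_closed meet_closed by metis
    have "z \<sqsubseteq>\<^bsub>L\<^esub> x" "z \<sqsubseteq>\<^bsub>L\<^esub> y"
      using meet_left[of "f x" "f y"] meet_right[of "f x" "f y"] xy z f_closed le by metis+
    then show "f x \<sqinter>\<^bsub>L\<^esub> f y \<sqsubseteq>\<^bsub>L\<^esub> f (x \<sqinter>\<^bsub>L\<^esub> y)"
      using xy z by (simp add: le meet_le)
  qed (use xy in \<open>auto intro!: meet_le meet_left meet_right simp: le f_closed\<close>)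
  ultimately show ?thesis
    using f L by (simp add: lattice_automorphism_def join_pres_def meet_pres_def)
qed

text \<open>Membership follows by cancelling \<rho> against \<rho>'. For minimality, \<chi> implies
  \<open>\<phi> \<star> \<rho>'\<close>; applying \<rho> to this implication and cancelling yields
  \<phi>.\<close>

lemma replace_mem_char_minmatrix:
  assumes S: "classical_modal_logic S"
    and \<rho>: "\<rho> \<in> uniform_replacements" and \<rho>': "\<rho>' \<in> uniform_replacements"
    and inv: "\<And>\<phi>. \<phi> \<star> \<rho> \<star> \<rho>' \<approx>\<^sub>E \<phi>" "\<And>\<phi>. \<phi> \<star> \<rho>' \<star> \<rho> \<approx>\<^sub>E \<phi>"
    and \<chi>: "\<chi> \<in> char_minmatrix S v d"
  shows "\<chi> \<star> \<rho> \<in> char_minmatrix {\<phi>. \<phi> \<star> \<rho>' \<in> S} v d"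
proof -
  have v: "vars \<rho> \<subseteq> {0}" "vars \<rho>' \<subseteq> {0}"
    using \<rho> \<rho>' by (auto simp: uniform_replacements_def)
  have \<chi>S: "\<chi> \<in> S \<inter> forms v d" and \<chi>_least: "\<And>\<phi>. \<phi> \<in> S \<inter> forms v d \<Longrightarrow> Imp \<chi> \<phi> \<in> logic_E"
    using \<chi> mem_char_minmatrix_iff[OF S] by blast+
  have "\<chi> \<star> \<rho> \<star> \<rho>' \<in> S"
    using \<chi>S inv(1) E_equiv_mem_logic_iff[OF S] by blast
  moreover have "\<chi> \<star> \<rho> \<in> forms v d"
    using \<chi>S \<rho> by (simp add: replace_mem_forms)
  moreover have "Imp (\<chi> \<star> \<rho>) \<phi> \<in> logic_E" if "\<phi> \<star> \<rho>' \<in> S" "\<phi> \<in> forms v d" for \<phi>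
  proof -
    have "Imp \<chi> (\<phi> \<star> \<rho>') \<in> logic_E"
      using that \<rho>' by (intro \<chi>_least) (simp add: replace_mem_forms)
    then have "Imp (\<chi> \<star> \<rho>) (\<phi> \<star> \<rho>' \<star> \<rho>) \<in> logic_E"
      using replace_mem_E[OF v(1)] by fastforce
    then show ?thesis
      using inv(2)[of \<phi>] Imp_E_trans unfolding E_equiv_iff_Imp by blast
  qed
  ultimately show ?thesis
    by (simp add: mem_char_minmatrix_iff classical_modal_logic_replace S v)
qed

text \<open>The first conjunct makes the definite description in \<open>replace_map\<close> denote:
  a single class receives the replacements of all representatives.\<close>

theorem theorem14:
  fixes \<rho> :: fm and v d :: nat
  assumes "\<rho> \<in> R_p1"
  shows "(\<forall>\<xi>\<in>char_minmatrices v d. \<exists>!\<eta>. \<eta> \<in> E_quot v d \<and> (\<forall>\<phi>\<in>\<xi>. \<phi> \<star> \<rho> \<in> \<eta>)) \<and>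
         replace_map \<rho> v d \<in> char_minmatrices v d \<rightarrow> char_minmatrices v d \<and>
         lattice_automorphism (minmatrix_order v d) (replace_map \<rho> v d)"
proof -
  obtain \<rho>' where \<rho>': "\<rho>' \<in> R_p1" and truth_fn:
      "\<And>a x y. truth_fn \<rho> a (truth_fn \<rho>' a x y) (truth_fn \<rho>' (\<not> a) y x) = x"
      "\<And>a x y. truth_fn \<rho>' a (truth_fn \<rho> a x y) (truth_fn \<rho> (\<not> a) y x) = x"
    using truth_fn_inverse[OF assms] by blast
  note inv = replace_R_p1_inverse[OF assms \<rho>' truth_fn(1)]
    replace_R_p1_inverse[OF \<rho>' assms truth_fn(2)]
  have ur: "\<rho> \<in> uniform_replacements" "\<rho>' \<in> uniform_replacements"
    using assms \<rho>' R_p1_uniform_replacements by auto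
  then have v: "vars \<rho> \<subseteq> {0}" "vars \<rho>' \<subseteq> {0}"
    by (auto simp: uniform_replacements_def)
  \<comment> \<open>Pulling back along the inverse \<rho>' pushes theorems forward along \<rho>:
    \<open>\<phi> \<star> \<rho>\<close> lies in \<open>act S\<close> exactly when \<phi> lies in
    \<open>S\<close>.\<close>
  define act where "act S = {\<phi>. \<phi> \<star> \<rho>' \<in> S}" for S
  have act: "classical_modal_logic (act S)" if "classical_modal_logic S" for S
    unfolding act_def using that v(2) by (rule classical_modal_logic_replace)
  have image: "char_minmatrix (act S) v d \<in> E_quot v d \<and>
      (\<forall>\<phi>\<in>char_minmatrix S v d. \<phi> \<star> \<rho> \<in> char_minmatrix (act S) v d)"
    if "classical_modal_logic S" for S
    using char_minmatrix_mem_E_quot[OF act[OF that]] replace_mem_char_minmatrix[OF that ur inv]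
    unfolding act_def by blast
  have unique: "\<eta> = char_minmatrix (act S) v d"
    if S: "classical_modal_logic S"
      and \<eta>: "\<eta> \<in> E_quot v d \<and> (\<forall>\<phi>\<in>char_minmatrix S v d. \<phi> \<star> \<rho> \<in> \<eta>)" for S \<eta>
  proof -
    obtain \<chi> where "\<chi> \<in> char_minmatrix S v d"
      using char_minmatrix_nonempty[OF S] .
    then have "\<chi> \<star> \<rho> \<in> \<eta> \<inter> char_minmatrix (act S) v d"
      using \<eta> image[OF S] by simp
    \<comment> \<open>Equivalence classes coincide or are disjoint, and these two share
      \<open>\<chi> \<star> \<rho>\<close>.\<close>
    moreover have "\<eta> = char_minmatrix (act S) v d \<or> \<eta> \<inter> char_minmatrix (act S) v d = {}"
      using \<eta> image[OF S] unfolding E_quot_def by (intro quotient_disj[OF equiv_E_rel]) auto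
    ultimately show ?thesis
      by blast
  qed
  have map: "replace_map \<rho> v d (char_minmatrix S v d) = char_minmatrix (act S) v d"
    if "classical_modal_logic S" for S
    unfolding replace_map_def using image[OF that] unique[OF that] by (rule the_equality)
  have le: "E_le (replace_map \<rho> v d \<xi>) (replace_map \<rho> v d \<eta>) \<longleftrightarrow> E_le \<xi> \<eta>"
    if \<xi>\<eta>: "\<xi> \<in> char_minmatrices v d" "\<eta> \<in> char_minmatrices v d" for \<xi> \<eta>
  proof -
    obtain S T where S: "classical_modal_logic S" "\<xi> = char_minmatrix S v d"
        and T: "classical_modal_logic T" "\<eta> = char_minmatrix T v d"
      using \<xi>\<eta> by (meson char_minmatricesE)
    have "act T \<inter> forms v d \<subseteq> act S \<inter> forms v d \<longleftrightarrow> T \<inter> forms v d \<subseteq> S \<inter> forms v d"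
    proof
      assume sub: "act T \<inter> forms v d \<subseteq> act S \<inter> forms v d"
      show "T \<inter> forms v d \<subseteq> S \<inter> forms v d"
      proof
        fix \<phi>
        assume \<phi>: "\<phi> \<in> T \<inter> forms v d"
        then have "\<phi> \<star> \<rho> \<in> act T \<inter> forms v d"
          using E_equiv_mem_logic_iff[OF T(1) inv(1)] replace_mem_forms[OF ur(1)]
          by (simp add: act_def)
        then have "\<phi> \<star> \<rho> \<star> \<rho>' \<in> S"
          using sub by (auto simp: act_def)
        then show "\<phi> \<in> S \<inter> forms v d"
          using \<phi> E_equiv_mem_logic_iff[OF S(1) inv(1)] by simp
      qed
    next
      assume "T \<inter> forms v d \<subseteq> S \<inter> forms v d"
      then show "act T \<inter> forms v d \<subseteq> act S \<inter> forms v d"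
        using replace_mem_forms[OF ur(2)] by (auto simp: act_def)
    qed
    then show ?thesis
      by (simp add: S T map act E_le_char_minmatrix_iff)
  qed
  have closed: "replace_map \<rho> v d \<in> char_minmatrices v d \<rightarrow> char_minmatrices v d"
    by (auto simp: map act char_minmatrix_mem elim!: char_minmatricesE)
  interpret lattice "minmatrix_order v d"
    by (rule lattice_minmatrix_order)
  have "inj_on (replace_map \<rho> v d) (char_minmatrices v d)"
  proof (rule inj_onI)
    fix \<xi> \<eta>
    assume *: "\<xi> \<in> char_minmatrices v d" "\<eta> \<in> char_minmatrices v d"
      "replace_map \<rho> v d \<xi> = replace_map \<rho> v d \<eta>"
    have "E_le \<xi> \<xi>"
      using le_refl[of \<xi>] *(1) by (simp add: minmatrix_order_def)
    then have "E_le \<xi> \<eta>" "E_le \<eta> \<xi>"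
      using le[OF *(1,1)] le[OF *(1,2)] le[OF *(2,1)] *(3) by simp_all
    then show "\<xi> = \<eta>"
      using le_antisym[of \<xi> \<eta>] *(1,2) by (simp add: minmatrix_order_def)
  qed
  moreover have "\<xi> \<in> replace_map \<rho> v d ` char_minmatrices v d"
    if "\<xi> \<in> char_minmatrices v d" for \<xi>
  proof -
    obtain S where S: "classical_modal_logic S" "\<xi> = char_minmatrix S v d"
      using \<open>\<xi> \<in> char_minmatrices v d\<close> by (rule char_minmatricesE)
    \<comment> \<open>Pulling back along \<rho> undoes \<open>act\<close>, so this logic supplies
      the preimage of \<xi>.\<close>
    define T where "T = {\<phi>. \<phi> \<star> \<rho> \<in> S}"
    have T: "classical_modal_logic T"
      unfolding T_def using S(1) v(1) by (rule classical_modal_logic_replace)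
    have "act T = S"
      using E_equiv_mem_logic_iff[OF S(1) inv(2)] by (auto simp: act_def T_def)
    then have "\<xi> = replace_map \<rho> v d (char_minmatrix T v d)"
      by (simp add: map T S)
    then show ?thesis
      using T char_minmatrix_mem by blast
  qed
  ultimately have "bij_betw (replace_map \<rho> v d) (char_minmatrices v d) (char_minmatrices v d)"
    using closed unfolding bij_betw_def by blast
  then have "lattice_automorphism (minmatrix_order v d) (replace_map \<rho> v d)"
    by (intro order_iso_lattice_automorphism lattice_minmatrix_order)
      (simp_all add: minmatrix_order_def le)
  moreover have "\<exists>!\<eta>. \<eta> \<in> E_quot v d \<and> (\<forall>\<phi>\<in>\<xi>. \<phi> \<star> \<rho> \<in> \<eta>)" if "\<xi> \<in> char_minmatrices v d" for \<xi>
  proof -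
    obtain S where S: "classical_modal_logic S" "\<xi> = char_minmatrix S v d"
      using \<open>\<xi> \<in> char_minmatrices v d\<close> by (rule char_minmatricesE)
    show ?thesis
      unfolding S(2) using image[OF S(1)] unique[OF S(1)] by (rule ex1I)
  qed
  ultimately show ?thesis
    using closed by blast
qed

end
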